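(* Let $\mathbf{K}$ be a non-Archimedean local field with local ring (ring of integers) $\mathbf{A}$, and let $\mathbf{A}^*$ be its group of units, acting on the additive group $\mathbf{K}$ by multiplication. Then the locally compact group $\mathbf{K}\rtimes\mathbf{A}^*$ has strong Property PL; that is, every semigroup length on $\mathbf{K}\rtimes\mathbf{A}^*$ is either bounded or proper.
   Context: A local field is a non-discrete locally compact field. A semigroup length on a locally compact group $G$ is a function $L:G\to[0,\infty[$ which is bounded on compact subsets of $G$ and satisfies $L(xy)\le L(x)+L(y)$ for all $x,y\in G$ (no continuity is assumed, and $L(1)=0$ is not required). It is proper if $L^{-1}([0,n])$ has compact closure in $G$ for every $n<\infty$. *)

theory Defs
  imports "HOL-Analysis.Analysis" "HOL-Algebra.Group"
begin

subsection \<open>Lengths on locally compact groups\<close>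

definition locally_compact_group :: "('g, 'm) monoid_scheme \<Rightarrow> 'g topology \<Rightarrow> bool" where
  "locally_compact_group G T \<longleftrightarrow>
     group G \<and> topspace T = carrier G \<and>
     continuous_map (prod_topology T T) T (\<lambda>(x, y). x \<otimes>\<^bsub>G\<^esub> y) \<and>
     continuous_map T T (\<lambda>x. inv\<^bsub>G\<^esub> x) \<and>
     Hausdorff_space T \<and> locally_compact_space T"

definition semigroup_length ::
    "('g, 'm) monoid_scheme \<Rightarrow> 'g topology \<Rightarrow> ('g \<Rightarrow> real) \<Rightarrow> bool" where
  "semigroup_length G T L \<longleftrightarrow>
     (\<forall>x \<in> carrier G. 0 \<le> L x) \<and>
     (\<forall>K. compactin T K \<longrightarrow> (\<exists>B. \<forall>x \<in> K. L x \<le> B)) \<and>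
     (\<forall>x \<in> carrier G. \<forall>y \<in> carrier G. L (x \<otimes>\<^bsub>G\<^esub> y) \<le> L x + L y)"

definition bounded_length :: "('g, 'm) monoid_scheme \<Rightarrow> ('g \<Rightarrow> real) \<Rightarrow> bool" where
  "bounded_length G L \<longleftrightarrow> (\<exists>B. \<forall>x \<in> carrier G. L x \<le> B)"

definition proper_length ::
    "('g, 'm) monoid_scheme \<Rightarrow> 'g topology \<Rightarrow> ('g \<Rightarrow> real) \<Rightarrow> bool" where
  "proper_length G T L \<longleftrightarrow>
     (\<forall>n::nat. compactin T (T closure_of {x \<in> carrier G. L x \<le> real n}))"

definition strong_property_PL :: "('g, 'm) monoid_scheme \<Rightarrow> 'g topology \<Rightarrow> bool" where
  "strong_property_PL G T \<longleftrightarrow>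
     (\<forall>L. semigroup_length G T L \<longrightarrow> bounded_length G L \<or> proper_length G T L)"


subsection \<open>Non-Archimedean local fields\<close>

text \<open>Topological fields are taken to be Hausdorff.  For a topological field, being non-discrete
  is the same as having no isolated point, which is what \<^class>\<open>perfect_space\<close> says.\<close>

class local_field = field + t2_space + perfect_space +
    topological_ab_group_add + topological_semigroup_mult +
  assumes tendsto_inverse_local_field: "a \<noteq> 0 \<Longrightarrow> filterlim inverse (nhds (inverse a)) (nhds a)"
    and locally_compact_local_field: "\<exists>U K. open U \<and> compact K \<and> a \<in> U \<and> U \<subseteq> K"

lemma continuous_on_inverse_local_field: "continuous_on (- {0 :: 'k::local_field}) inverse"
  unfolding continuous_on_def
  by (auto intro: filterlim_mono[OF tendsto_inverse_local_field] simp: at_within_def)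

lemma Hausdorff_space_local_field: "Hausdorff_space (euclidean :: 'k::t2_space topology)"
  unfolding Hausdorff_space_def disjnt_def by (metis hausdorff open_openin)

lemma locally_compact_space_local_field:
  "locally_compact_space (euclidean :: 'k::local_field topology)"
  using locally_compact_local_field by (auto simp: locally_compact_space_def)

text \<open>A local field is non-Archimedean if its topology is defined by an ultrametric absolute
  value.  Such an absolute value is unique up to a positive power, so that its closed unit ball,
  the ring of integers, depends on the topological field only.\<close>

definition nonarchimedean_absolute_value :: "('k::local_field \<Rightarrow> real) \<Rightarrow> bool" where
  "nonarchimedean_absolute_value v \<longleftrightarrow>
     (\<forall>x. 0 \<le> v x) \<and>
     (\<forall>x. v x = 0 \<longleftrightarrow> x = 0) \<and>
     (\<forall>x y. v (x * y) = v x * v y) \<and>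
     (\<forall>x y. v (x + y) \<le> max (v x) (v y)) \<and>
     (\<forall>U. open U \<longleftrightarrow> (\<forall>x \<in> U. \<exists>e > 0. \<forall>y. v (y - x) < e \<longrightarrow> y \<in> U))"

definition ring_of_integers :: "('k::local_field \<Rightarrow> real) \<Rightarrow> 'k set" where
  "ring_of_integers v = {x. v x \<le> 1}"

definition integer_units :: "('k::local_field \<Rightarrow> real) \<Rightarrow> 'k set" where
  "integer_units v =
     {u \<in> ring_of_integers v. \<exists>w \<in> ring_of_integers v. u * w = 1}"


subsection \<open>The semidirect product of the additive group with the units\<close>

definition semidirect_units :: "('k::local_field \<Rightarrow> real) \<Rightarrow> ('k \<times> 'k) monoid" where
  "semidirect_units v =
     \<lparr> carrier = UNIV \<times> integer_units v,
       monoid.mult = (\<lambda>(x, u) (y, w). (x + u * y, u * w)),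
       one = (0, 1) \<rparr>"

definition semidirect_units_topology :: "('k::local_field \<Rightarrow> real) \<Rightarrow> ('k \<times> 'k) topology" where
  "semidirect_units_topology v =
     prod_topology euclidean (subtopology euclidean (integer_units v))"

lemma integer_units_eq:
  assumes "nonarchimedean_absolute_value (v :: 'k::local_field \<Rightarrow> real)"
  shows "integer_units v = {u. v u = 1}"
proof -
  have z: "v x = 0 \<longleftrightarrow> x = 0" and m: "v (x * y) = v x * v y" and p: "0 \<le> v x" for x y
    using assms by (auto simp: nonarchimedean_absolute_value_def)
  have one: "v 1 = 1" using m[of 1 1] z[of 1] by simp
  show ?thesis
  proof (intro equalityI subsetI)
    fix u assume "u \<in> integer_units v"
    then obtain w where w: "v u \<le> 1" "v w \<le> 1" "u * w = 1"
      by (auto simp: integer_units_def ring_of_integers_def)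
    then have "v u * v w = 1" using m[of u w] one by simp
    then have "1 \<le> v u" using mult_left_le[OF w(2) p[of u]] by simp
    then show "u \<in> {u. v u = 1}" using w(1) by simp
  next
    fix u assume "u \<in> {u. v u = 1}"
    then have u: "v u = 1" by simp
    then have nz: "u \<noteq> 0" using z[of u] by auto
    then have "v (inverse u) = 1" using m[of u "inverse u"] u one by simp
    then show "u \<in> integer_units v" using u nz
      by (auto simp: integer_units_def ring_of_integers_def intro!: exI[of _ "inverse u"])
  qed
qed

lemma locally_compact_group_semidirect_units:
  assumes v: "nonarchimedean_absolute_value (v :: 'k::local_field \<Rightarrow> real)"
  shows "locally_compact_group (semidirect_units v) (semidirect_units_topology v)"
proof -
  let ?A = "integer_units v"
  let ?G = "semidirect_units v"
  let ?T = "semidirect_units_topology v"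
  have z: "v x = 0 \<longleftrightarrow> x = 0" and m: "v (x * y) = v x * v y" and p: "0 \<le> v x"
    and a: "v (x + y) \<le> max (v x) (v y)" for x y
    using v by (auto simp: nonarchimedean_absolute_value_def)
  have op: "open U \<longleftrightarrow> (\<forall>x \<in> U. \<exists>e > 0. \<forall>y. v (y - x) < e \<longrightarrow> y \<in> U)" for U
    using v by (auto simp: nonarchimedean_absolute_value_def)
  have A: "?A = {u. v u = 1}" by (rule integer_units_eq[OF v])
  have one: "v 1 = 1" using m[of 1 1] z[of 1] by simp
  have nz: "u \<noteq> 0" if "u \<in> ?A" for u using that z[of u] by (auto simp: A)
  have vinv: "v (inverse u) = 1" if "v u = 1" for u
    using m[of u "inverse u"] that one z[of u] by (cases "u = 0") auto
  have neg1: "v (- 1) = 1"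
    using m[of "-1" "-1"] one p[of "-1"] by (simp add: square_eq_1_iff)
  have neg: "v (- x) = v x" for x using m[of "-1" x] neg1 by simp
  have "open ?A"
    unfolding op
  proof
    fix x assume "x \<in> ?A"
    then have x: "v x = 1" by (simp add: A)
    have "y \<in> ?A" if "v (y - x) < 1" for y
      using a[of x "y - x"] a[of y "x - y"] neg[of "y - x"] that x by (simp add: A)
    then show "\<exists>e>0. \<forall>y. v (y - x) < e \<longrightarrow> y \<in> ?A" by (intro exI[of _ 1]) auto
  qed
  then have lcA: "locally_compact_space (subtopology euclidean ?A)"
    by (intro locally_compact_space_open_subset)
      (auto simp: locally_compact_space_local_field Hausdorff_space_local_field)
  have T: "?T = subtopology euclidean (UNIV \<times> ?A)"
    unfolding semidirect_units_topology_def
    using prod_topology_subtopology_eu[of UNIV ?A] by simp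
  have TT: "prod_topology ?T ?T = subtopology euclidean ((UNIV \<times> ?A) \<times> (UNIV \<times> ?A))"
    unfolding T by simp
  have inv1: "(- (inverse u * x), inverse u) \<in> carrier ?G"
    "(- (inverse u * x), inverse u) \<otimes>\<^bsub>?G\<^esub> (x, u) = \<one>\<^bsub>?G\<^esub>" if "u \<in> ?A" for x u
    using that nz[OF that] vinv by (auto simp: semidirect_units_def A)
  have G: "group ?G"
  proof (rule groupI)
    show "\<And>x. x \<in> carrier ?G \<Longrightarrow> \<exists>y\<in>carrier ?G. y \<otimes>\<^bsub>?G\<^esub> x = \<one>\<^bsub>?G\<^esub>"
    proof -
      fix p assume "p \<in> carrier ?G"
      then obtain x u where "p = (x, u)" "u \<in> ?A" by (auto simp: semidirect_units_def)
      then show "\<exists>y\<in>carrier ?G. y \<otimes>\<^bsub>?G\<^esub> p = \<one>\<^bsub>?G\<^esub>" using inv1[of u x] by blast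
    qed
  qed (auto simp: semidirect_units_def A one m algebra_simps)
  have inv: "inv\<^bsub>?G\<^esub> (x, u) = (- (inverse u * x), inverse u)" if "u \<in> ?A" for x u
    using inv1[OF that, of x] that
    by (intro group.inv_equality[OF G]) (auto simp: semidirect_units_def)
  have ci: "continuous_on ?A inverse"
    using continuous_on_inverse_local_field by (rule continuous_on_subset) (use nz in auto)
  have c2: "continuous_on (UNIV \<times> ?A) (\<lambda>p. inverse (snd p))"
    by (rule continuous_on_compose2[OF ci]) (auto intro: continuous_intros)
  have "continuous_on (UNIV \<times> ?A) (\<lambda>p. (- (inverse (snd p) * fst p), inverse (snd p)))"
    by (intro continuous_intros c2 continuous_on_mult')
  then have "continuous_on (UNIV \<times> ?A) (\<lambda>x. inv\<^bsub>?G\<^esub> x)"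
    by (rule continuous_on_eq) (use inv in auto)
  then have cinv: "continuous_map ?T ?T (\<lambda>x. inv\<^bsub>?G\<^esub> x)"
    using group.inv_closed[OF G]
    by (auto simp: T continuous_map_in_subtopology semidirect_units_def inv A vinv)
  have "continuous_on ((UNIV \<times> ?A) \<times> (UNIV \<times> ?A))
      (\<lambda>p. (fst (fst p) + snd (fst p) * fst (snd p), snd (fst p) * snd (snd p)))"
    by (intro continuous_intros continuous_on_mult')
  then have cm: "continuous_map (prod_topology ?T ?T) ?T (\<lambda>(x, y). x \<otimes>\<^bsub>?G\<^esub> y)"
    unfolding TT
    by (auto simp: T continuous_map_in_subtopology semidirect_units_def case_prod_unfold A m)
  show ?thesis
    unfolding locally_compact_group_def
  proof (intro conjI G cm cinv)
    show "topspace ?T = carrier ?G"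
      by (simp add: T semidirect_units_def)
    show "Hausdorff_space ?T"
      unfolding T by (intro Hausdorff_space_subtopology Hausdorff_space_local_field)
    show "locally_compact_space ?T"
      unfolding semidirect_units_topology_def
      by (simp add: locally_compact_space_prod_topology locally_compact_space_local_field lcA)
  qed
qed

end

theory Submission
  imports Defs
begin

text \<open>If a length \<open>L\<close> is not proper, some sublevel set contains points \<open>(x, w)\<close> with \<open>v x\<close>
  arbitrarily large, because balls of \<open>\<^bold>K\<close> are compact.  Multiplying on both sides by the compact
  group \<open>\<^bold>A\<^sup>*\<close> bounds \<open>L\<close> uniformly on the whole sphere of radius \<open>v x\<close>.  By the ultrametric
  inequality each \<open>y\<close> with \<open>v y < v x\<close> is the sum of the two points \<open>y - x\<close> and \<open>x\<close> of this
  sphere, so \<open>L\<close> is bounded.\<close>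

locale nonarchimedean_local_field =
  fixes v :: "'k::local_field \<Rightarrow> real"
  assumes v: "nonarchimedean_absolute_value v"
begin

lemma v_nonneg: "0 \<le> v x"
  and v_eq_0_iff: "v x = 0 \<longleftrightarrow> x = 0"
  and v_mult: "v (x * y) = v x * v y"
  and v_add_le: "v (x + y) \<le> max (v x) (v y)"
  and open_iff: "open U \<longleftrightarrow> (\<forall>x\<in>U. \<exists>e>0. \<forall>y. v (y - x) < e \<longrightarrow> y \<in> U)"
  by (insert v[unfolded nonarchimedean_absolute_value_def], elim conjE, (erule allE)+, assumption)+

lemma v_one: "v 1 = 1"
  using v_mult[of 1 1] v_eq_0_iff[of 1] by simp

lemma v_divide: "v (x / y) = v x / v y"
proof (cases "y = 0")
  case True
  \<comment> \<open>Both sides are 0, since division by 0 yields 0 in \<open>'k\<close> and in the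
    reals.\<close>
  then show ?thesis using v_eq_0_iff[of 0] by simp
next
  case False
  then show ?thesis using v_mult[of "x / y" y] v_eq_0_iff[of y] by (simp add: field_simps)
qed

lemma v_power: "v (x ^ n) = v x ^ n"
  by (induction n) (auto simp: v_one v_mult)

lemma v_minus: "v (- x) = v x"
proof -
  have "v (-1) = 1"
    using v_mult[of "-1" "-1"] v_one v_nonneg[of "-1"] by (simp add: square_eq_1_iff)
  then show ?thesis using v_mult[of "-1" x] by simp
qed

text \<open>Ultrametric triangles are isosceles: \<open>x = y - (y - x)\<close> with
  \<open>v y < v x\<close> forces \<open>v x \<le> v (y - x)\<close>, and the other inequality is
  direct.\<close>

lemma v_diff_eq:
  assumes "v y < v x"
  shows "v (y - x) = v x"
  using v_add_le[of y "- x"] v_add_le[of y "x - y"] v_minus[of x] v_minus[of "y - x"] assms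
  by simp

text \<open>The ultrametric inequality gives the reverse triangle inequality, so \<open>v\<close> is
  1-Lipschitz for the balls that define the topology.\<close>

lemma continuous_on_v: "continuous_on UNIV v"
proof -
  have "open (v -` U)" if "open U" for U
    unfolding open_iff
  proof
    fix x assume "x \<in> v -` U"
    then obtain e where e: "e > 0" "\<And>r. \<bar>r - v x\<bar> < e \<Longrightarrow> r \<in> U"
      using \<open>open U\<close> by (auto simp: open_dist dist_real_def)
    have "\<bar>v y - v x\<bar> \<le> v (y - x)" for y
      using v_add_le[of x "y - x"] v_add_le[of y "x - y"] v_minus[of "y - x"]
        v_nonneg[of x] v_nonneg[of y] v_nonneg[of "y - x"] by simp
    then show "\<exists>e>0. \<forall>y. v (y - x) < e \<longrightarrow> y \<in> v -` U"
      using e by (metis le_less_trans vimageI)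
  qed
  then show ?thesis by (simp add: continuous_on_open_vimage)
qed

lemma closed_ball_closed: "closed {x. v x \<le> r}"
  by (intro closed_Collect_le continuous_on_v continuous_on_const)

text \<open>Non-discreteness enters here: the open unit ball contains some \<open>x\<close> other
  than 0, and the powers of \<open>1 / x\<close> have unbounded value.\<close>

lemma exists_v_gt: "\<exists>z. v z > r"
proof -
  have "open {x. v x < 1}"
    by (intro open_Collect_less continuous_on_v continuous_on_const)
  then have "{x. v x < 1} \<noteq> {0}"
    using not_open_singleton by metis
  moreover have "0 \<in> {x. v x < 1}" using v_eq_0_iff[of 0] by simp
  ultimately obtain x where x: "v x < 1" "x \<noteq> 0" by blast
  then have "v (1 / x) > 1"
    using v_nonneg[of x] v_eq_0_iff[of x] by (simp add: v_divide v_one)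
  then obtain n where "r < v (1 / x) ^ n" using real_arch_pow by blast
  then show ?thesis by (metis v_power)
qed

text \<open>Local compactness makes a small ball around 0 compact; multiplication by an element of
  large value expands it to cover the given ball, which is closed.\<close>

lemma compact_closed_ball: "compact {x. v x \<le> r}"
proof -
  obtain U C :: "'k set" where UC: "open U" "compact C" "0 \<in> U" "U \<subseteq> C"
    using locally_compact_local_field[of 0] by blast
  then obtain e where e: "e > 0" "\<And>y. v y < e \<Longrightarrow> y \<in> U"
    unfolding open_iff by (metis diff_zero)
  have "compact (C \<inter> {x. v x \<le> e / 2})"
    using UC(2) closed_ball_closed by (rule compact_Int_closed)
  moreover have "C \<inter> {x. v x \<le> e / 2} = {x. v x \<le> e / 2}"
    using e UC(4) by force
  ultimately have cpt: "compact {x. v x \<le> e / 2}" by simp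
  \<comment> \<open>The \<open>max 0\<close> forces \<open>z\<close> to be nonzero even when
    \<open>r\<close> is negative.\<close>
  obtain z where z: "v z > max 0 (r / (e / 2))" using exists_v_gt by blast
  then have zpos: "v z > 0" and z0: "z \<noteq> 0" and zr: "r / v z < e / 2"
    using v_eq_0_iff[of z] e(1) by (auto simp: field_simps)
  have "compact ((\<lambda>x. z * x) ` {x. v x \<le> e / 2})"
    by (intro compact_continuous_image cpt continuous_on_mult' continuous_intros)
  then have "compact ((\<lambda>x. z * x) ` {x. v x \<le> e / 2} \<inter> {x. v x \<le> r})"
    using closed_ball_closed by (rule compact_Int_closed)
  moreover have "x \<in> (\<lambda>x. z * x) ` {x. v x \<le> e / 2}" if "v x \<le> r" for x
  proof (rule image_eqI)
    show "x = z * (x / z)" using z0 by simp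
    have "v x / v z \<le> r / v z" using that zpos by (simp add: divide_right_mono)
    then have "v (x / z) \<le> e / 2" using zr unfolding v_divide by linarith
    then show "x / z \<in> {x. v x \<le> e / 2}" by simp
  qed
  then have "(\<lambda>x. z * x) ` {x. v x \<le> e / 2} \<inter> {x. v x \<le> r} = {x. v x \<le> r}" by blast
  ultimately show ?thesis by simp
qed

lemma mem_integer_units: "u \<in> integer_units v \<longleftrightarrow> v u = 1"
  using integer_units_eq[OF v] by simp

lemma compact_integer_units: "compact (integer_units v)"
proof -
  have "closed {u. v u = 1}"
    by (intro closed_Collect_eq continuous_on_v continuous_on_const)
  then have "closed (integer_units v)" by (simp add: integer_units_eq[OF v])
  moreover have "integer_units v \<subseteq> {x. v x \<le> 1}" by (auto simp: mem_integer_units)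
  ultimately show ?thesis
    using compact_Int_closed[OF compact_closed_ball[of 1]] by (metis inf.absorb2)
qed

lemma compactin_Times_integer_units:
  assumes "compact C"
  shows "compactin (semidirect_units_topology v) (C \<times> integer_units v)"
  using assms compact_integer_units
  by (simp add: semidirect_units_topology_def compactin_Times compactin_subtopology)

text \<open>A sublevel set with first coordinates in a ball lies in a compact product, which is
  closed as the group is Hausdorff, so its closure is compact. A single \<open>n\<close> serves all
  \<open>r\<close>.\<close>

lemma unbounded_sublevel_if_not_proper:
  assumes "\<not> proper_length (semidirect_units v) (semidirect_units_topology v) L"
  shows "\<exists>n::nat. \<forall>r. \<exists>x w. v w = 1 \<and> L (x, w) \<le> real n \<and> r < v x"
proof -
  let ?T = "semidirect_units_topology v" and ?G = "semidirect_units v"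
  obtain n where n: "\<not> compactin ?T (?T closure_of {p \<in> carrier ?G. L p \<le> real n})"
    using assms by (auto simp: proper_length_def)
  let ?S = "{p \<in> carrier ?G. L p \<le> real n}"
  have "\<exists>x w. v w = 1 \<and> L (x, w) \<le> real n \<and> r < v x" for r
  proof (rule ccontr)
    assume "\<not> ?thesis"
    then have sub: "?S \<subseteq> {x. v x \<le> r} \<times> integer_units v"
      by (force simp: semidirect_units_def mem_integer_units)
    have cpt: "compactin ?T ({x. v x \<le> r} \<times> integer_units v)"
      by (intro compactin_Times_integer_units compact_closed_ball)
    have "Hausdorff_space ?T"
      using locally_compact_group_semidirect_units[OF v] by (simp add: locally_compact_group_def)
    then have "closedin ?T ({x. v x \<le> r} \<times> integer_units v)"
      using cpt by (rule compactin_imp_closedin)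
    then have "?T closure_of ?S \<subseteq> {x. v x \<le> r} \<times> integer_units v"
      using sub by (rule closure_of_minimal[rotated])
    then show False
      using n closed_compactin[OF cpt] closedin_closure_of by blast
  qed
  then show ?thesis by blast
qed

lemma semigroup_length_mult_le:
  assumes "semigroup_length (semidirect_units v) (semidirect_units_topology v) L"
    and "v b = 1" "v d = 1"
  shows "L (a + b * c, b * d) \<le> L (a, b) + L (c, d)"
proof -
  have "(a, b) \<in> carrier (semidirect_units v)" "(c, d) \<in> carrier (semidirect_units v)"
    using assms(2,3) by (simp_all add: semidirect_units_def mem_integer_units)
  then have "L ((a, b) \<otimes>\<^bsub>semidirect_units v\<^esub> (c, d)) \<le> L (a, b) + L (c, d)"
    using assms(1) unfolding semigroup_length_def by blast
  then show ?thesis by (simp add: semidirect_units_def)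
qed

text \<open>In the group, \<open>(y, t)\<close> is the product of \<open>(0, a)\<close>,
  \<open>(x, w)\<close> and \<open>(0, b)\<close> with units \<open>a = y / x\<close> and
  \<open>b = t / (a * w)\<close>; each outer factor costs at most \<open>C\<close>.\<close>

lemma length_le_on_sphere:
  assumes L: "semigroup_length (semidirect_units v) (semidirect_units_topology v) L"
    and C: "\<And>u. v u = 1 \<Longrightarrow> L (0, u) \<le> C"
    and "v x > 0" "v y = v x" "v w = 1" "v t = 1"
  shows "L (y, t) \<le> L (x, w) + 2 * C"
proof -
  note sub = semigroup_length_mult_le[OF L]
  define a where "a = y / x"
  define b where "b = t / (a * w)"
  have nz: "x \<noteq> 0" "y \<noteq> 0" "w \<noteq> 0"
    using assms(3-5) v_eq_0_iff[of x] v_eq_0_iff[of y] v_eq_0_iff[of w] by auto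
  have ab: "v a = 1" "v b = 1" using assms(3-6) by (simp_all add: a_def b_def v_divide v_mult)
  \<comment> \<open>The zero summand exhibits the product of \<open>(a * x, a * w)\<close> and
    \<open>(0, b)\<close>.\<close>
  have "L (y, t) = L (a * x + (a * w) * 0, (a * w) * b)"
    using nz by (simp add: a_def b_def)
  also have "\<dots> \<le> L (a * x, a * w) + L (0, b)"
    using assms(5) ab by (intro sub) (simp_all add: v_mult)
  also have "L (a * x, a * w) \<le> L (0, a) + L (x, w)"
    using sub[of a w 0 x] ab assms(5) by simp
  finally show ?thesis using C[OF ab(1)] C[OF ab(2)] by simp
qed

theorem strong_property_PL_semidirect_units:
  "strong_property_PL (semidirect_units v) (semidirect_units_topology v)"
  unfolding strong_property_PL_def
proof (intro allI impI)
  let ?T = "semidirect_units_topology v" and ?G = "semidirect_units v"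
  fix L assume L: "semigroup_length ?G ?T L"
  note sub = semigroup_length_mult_le[OF L]
  \<comment> \<open>The units embed as a compact subgroup, on which \<open>L\<close> is bounded by
    some \<open>C\<close>.\<close>
  have "compactin ?T ({0} \<times> integer_units v)"
    by (intro compactin_Times_integer_units) simp
  then obtain C where C: "\<And>u. v u = 1 \<Longrightarrow> L (0, u) \<le> C"
    using L unfolding semigroup_length_def by (metis SigmaI mem_integer_units singletonI)
  show "bounded_length ?G L \<or> proper_length ?G ?T L"
  proof (rule disjCI)
    assume "\<not> proper_length ?G ?T L"
    then obtain n where n: "\<And>r. \<exists>x w. v w = 1 \<and> L (x, w) \<le> real n \<and> r < v x"
      using unbounded_sublevel_if_not_proper by metis
    have "L (y, t) \<le> 2 * (n + 2 * C)" if t: "v t = 1" for y t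
    proof -
      \<comment> \<open>The point \<open>x\<close> depends on \<open>y\<close>, but the bound
        \<open>n + 2 * C\<close> on its sphere does not.\<close>
      obtain x w where x: "v w = 1" "L (x, w) \<le> n" "v y < v x" using n by blast
      have sphere: "L (y', t') \<le> n + 2 * C" if "v y' = v x" "v t' = 1" for y' t'
        using length_le_on_sphere[OF L C _ that(1) x(1) that(2)] x v_nonneg[of y] by simp
      \<comment> \<open>The unit 1 acts trivially, so this product adds first coordinates, and both
        factors lie over the sphere of \<open>x\<close>.\<close>
      have "L (y, t) = L ((y - x) + 1 * x, 1 * t)" by simp
      also have "\<dots> \<le> L (y - x, 1) + L (x, t)"
        using t by (intro sub) (simp_all add: v_one)
      also have "\<dots> \<le> 2 * (n + 2 * C)"
        using sphere[OF v_diff_eq[OF x(3)] v_one] sphere[OF refl t] by simp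
      finally show ?thesis .
    qed
    then show "bounded_length ?G L"
      unfolding bounded_length_def semidirect_units_def
      by (auto simp: mem_integer_units intro!: exI[of _ "2 * (n + 2 * C)"])
  qed
qed

end

theorem proposition1p9:
  fixes v :: "'k::local_field \<Rightarrow> real"
  assumes "nonarchimedean_absolute_value v"
  shows "strong_property_PL (semidirect_units v) (semidirect_units_topology v)"
  using assms
  by (intro nonarchimedean_local_field.strong_property_PL_semidirect_units
      nonarchimedean_local_field.intro)

end
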